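(* Let $k\ge 2$, let $\Omega\subset\mathbb R^d$ be a domain, and let $\overline\phi_n=(\phi_{1,n}(\mathbf x),\dots,\phi_{k,n}(\mathbf x))$, $n\in\mathbb Z_+$, be a sequence of $k$-tuples of complex-valued functions on $\Omega$ such that each $\phi_{k,n}$ is non-vanishing in $\Omega$ and $\overline\phi_n$ converges pointwise in $\Omega$ to a $k$-tuple of functions $\widetilde\phi=(\widetilde\phi_1(\mathbf x),\dots,\widetilde\phi_k(\mathbf x))$. Let $I=(f_0(\mathbf x),\dots,f_{k-1}(\mathbf x))$ be some initial $k$-tuple of complex-valued functions defined on $\Omega$, and let $\{f_n(\mathbf x)\}_{n\in\mathbb Z_+}$ be the family of functions with these first $k$ members satisfying $$f_{n+k}(\mathbf x)+\sum_{i=1}^k\phi_{i,n}(\mathbf x)f_{n+k-i}(\mathbf x)=0,\qquad n\ge 0.$$ Then there exists a unique subset $\Sigma_I\subseteq\Omega\setminus\Xi_{\widetilde\phi}$ which is minimal with respect to inclusion and such that the following holds: (i) For any $\mathbf x\in\Omega\setminus(\Xi_{\widetilde\phi}\cup\Sigma_I)$ one has $\lim_{n\to\infty}\frac{f_{n+1}(\mathbf x)}{f_n(\mathbf x)}=\Psi_{max}(\mathbf x)$, where $\Psi_{max}(\mathbf x)$ is the leading root of the asymptotic symbol equation $$\Psi^k+\widetilde\phi_1(\mathbf x)\Psi^{k-1}+\widetilde\phi_2(\mathbf x)\Psi^{k-2}+\dots+\widetilde\phi_k(\mathbf x)=0 .$$ (ii) If $\overline\phi_n$ consists of continuous functions and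 $\overline\phi_n\to\widetilde\phi$ uniformly on compact subsets of $\Omega$, then $\frac{f_{n+1}(\mathbf x)}{f_n(\mathbf x)}\to\Psi_{max}(\mathbf x)$ uniformly on compact subsets of $\Omega\setminus(\Xi_{\widetilde\phi}\cup\Sigma_I)$.
   Context: A monic polynomial of degree $k$ is called maxmod-generic if among its roots there is a unique root of maximal absolute value and this root is simple; this root is called the leading root. Otherwise the polynomial is called maxmod-nongeneric. The induced maxmod-discriminant $\Xi_{\widetilde\phi}\subseteq\Omega$ is the set of all $\mathbf x\in\Omega$ for which the polynomial $\Psi^k+\widetilde\phi_1(\mathbf x)\Psi^{k-1}+\dots+\widetilde\phi_k(\mathbf x)$ in $\Psi$ is maxmod-nongeneric.
   Formalization: In (ii) the initial functions f_0,…,f_{k-1} are also assumed continuous on Ω; without this the claim fails, e.g. for Ω=ℝ, k=2, φ_1=-3, φ_2=2, f_n = a·2^n+1 with a(p/q)=1/q in lowest terms and a=1 at irrationals. *)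

theory Defs
  imports "HOL-Analysis.Analysis" "HOL-Computational_Algebra.Polynomial"
begin

definition maxmod_root :: "complex poly \<Rightarrow> complex \<Rightarrow> bool" where
  "maxmod_root p z \<longleftrightarrow> poly p z = 0 \<and> (\<forall>w. poly p w = 0 \<longrightarrow> cmod w \<le> cmod z)"

definition maxmod_generic :: "complex poly \<Rightarrow> bool" where
  "maxmod_generic p \<longleftrightarrow> (\<exists>!z. maxmod_root p z) \<and> (\<forall>z. maxmod_root p z \<longrightarrow> order z p = 1)"

text \<open>Meaningful only for a maxmod-generic polynomial.\<close>
definition leading_root :: "complex poly \<Rightarrow> complex" where
  "leading_root p = (THE z. maxmod_root p z)"

definition symbol_poly :: "nat \<Rightarrow> (nat \<Rightarrow> complex) \<Rightarrow> complex poly" where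
  "symbol_poly k c = monom 1 k + (\<Sum>i=1..k. monom (c i) (k - i))"

lemma poly_symbol_poly: "poly (symbol_poly k c) z = z ^ k + (\<Sum>i=1..k. c i * z ^ (k - i))"
  by (simp add: symbol_poly_def poly_sum poly_monom)

lemma
  degree_symbol_poly: "degree (symbol_poly k c) = k" and
  monic_symbol_poly: "lead_coeff (symbol_poly k c) = 1"
proof -
  have high: "coeff (\<Sum>i=1..k. monom (c i) (k - i)) n = 0" if "n \<ge> k" for n
    using that by (auto simp: coeff_sum intro!: sum.neutral)
  then have top: "coeff (symbol_poly k c) k = 1"
    by (simp add: symbol_poly_def)
  moreover have "coeff (symbol_poly k c) n = 0" if "n > k" for n
    using that high by (simp add: symbol_poly_def)
  ultimately show deg: "degree (symbol_poly k c) = k"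
    by (intro antisym degree_le le_degree) auto
  show "lead_coeff (symbol_poly k c) = 1"
    using deg top by simp
qed

definition maxmod_discriminant ::
  "nat \<Rightarrow> 'a set \<Rightarrow> (nat \<Rightarrow> 'a \<Rightarrow> complex) \<Rightarrow> 'a set" where
  "maxmod_discriminant k \<Omega> c = {x \<in> \<Omega>. \<not> maxmod_generic (symbol_poly k (\<lambda>i. c i x))}"

definition \<Psi>max :: "nat \<Rightarrow> (nat \<Rightarrow> 'a \<Rightarrow> complex) \<Rightarrow> 'a \<Rightarrow> complex" where
  "\<Psi>max k c x = leading_root (symbol_poly k (\<lambda>i. c i x))"

definition uniform_limit_on_compacts ::
  "'a::topological_space set \<Rightarrow> (nat \<Rightarrow> 'a \<Rightarrow> complex) \<Rightarrow> ('a \<Rightarrow> complex) \<Rightarrow> bool" where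
  "uniform_limit_on_compacts S g h \<longleftrightarrow>
     (\<forall>K. compact K \<and> K \<subseteq> S \<longrightarrow> uniform_limit K g h sequentially)"

text \<open>
  In both limits below the quotient is total, with value 0 where the denominator vanishes.
  This is harmless: for \<open>k \<ge> 2\<close> the simple leading root is nonzero, so convergence of the
  quotients to it already forces \<open>f n x \<noteq> 0\<close> for all large \<open>n\<close>.
\<close>
definition ratio_limit ::
  "(nat \<Rightarrow> 'a \<Rightarrow> complex) \<Rightarrow> 'a set \<Rightarrow> ('a \<Rightarrow> complex) \<Rightarrow> bool" where
  "ratio_limit f S \<psi> \<longleftrightarrow> (\<forall>x\<in>S. (\<lambda>n. f (n + 1) x / f n x) \<longlonglongrightarrow> \<psi> x)"

definition ratio_limit_on_compacts ::
  "(nat \<Rightarrow> 'a::topological_space \<Rightarrow> complex) \<Rightarrow> 'a set \<Rightarrow> ('a \<Rightarrow> complex) \<Rightarrow> bool" where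
  "ratio_limit_on_compacts f S \<psi> \<longleftrightarrow>
     uniform_limit_on_compacts S (\<lambda>n x. f (n + 1) x / f n x) \<psi>"

definition inclusion_minimal :: "('a set \<Rightarrow> bool) \<Rightarrow> 'a set \<Rightarrow> bool" where
  "inclusion_minimal P S \<longleftrightarrow> P S \<and> (\<forall>T. P T \<and> T \<subseteq> S \<longrightarrow> T = S)"

end

theory Submission
  imports Defs "HOL-Computational_Algebra.Fundamental_Theorem_Algebra"
begin

text \<open>
  The set \<open>\<Sigma>\<close> consists of the points where the ratios fail to converge to the leading root; only the
  uniform convergence on compact sets off \<open>\<Xi> \<union> \<Sigma>\<close> needs an argument. Let \<open>\<kappa>\<close> be the leading root at
  such a point \<open>x\<close> and let \<open>E\<close> be the shift. Then \<open>g n = f (n + 1) - \<kappa> f n\<close> satisfies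
  \<open>(\<Prod>\<mu>. E - \<mu>) g = error\<close>, where \<open>\<mu>\<close> runs over the other roots, all of modulus below \<open>|\<kappa>|\<close>. In a norm
  adapted to this factorization the cone \<open>\<parallel>g\<parallel> \<le> \<tau> |f|\<close> is invariant as soon as the coefficients are
  close to their limits at \<open>x\<close>. Convergence of the ratios at \<open>x\<close> puts the solution into the cone at
  some time, continuity of the terms involved does so for all nearby points at the same time, and
  the cone then keeps their ratios close to \<open>\<kappa>\<close> forever.
\<close>

section \<open>The factored shift operator and its adapted norm\<close>

fun shift_prod :: "complex list \<Rightarrow> (nat \<Rightarrow> complex) \<Rightarrow> nat \<Rightarrow> complex" where
  "shift_prod [] g = g"
| "shift_prod (\<mu> # \<mu>s) g = shift_prod \<mu>s (\<lambda>n. g (Suc n) - \<mu> * g n)"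

text \<open>Put g_0 = g and let g_i arise from g_(i-1) by applying E - \<mu>_i, where E is the
  shift. The value is the weighted sum of w^i |g_i(n)| over i below the length of
  \<open>\<mu>s\<close>. In the coordinates w^i g_i the off-diagonal entries of the recurrence
  shrink to 1/w, so a large \<open>w\<close> makes it almost diagonal.\<close>

fun shift_norm :: "real \<Rightarrow> complex list \<Rightarrow> (nat \<Rightarrow> complex) \<Rightarrow> nat \<Rightarrow> real" where
  "shift_norm w [] g n = 0"
| "shift_norm w (\<mu> # \<mu>s) g n =
    cmod (g n) + w * shift_norm w \<mu>s (\<lambda>n. g (Suc n) - \<mu> * g n) n"

text \<open>Substituting E for the polynomial variable turns multiplication of linear factors into
  composition. This links the factored operator to a recurrence given by coefficients.\<close>

lemma shift_prod_eq_sum_coeff: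
  "shift_prod \<mu>s g n =
    (\<Sum>i\<le>length \<mu>s. coeff (\<Prod>\<mu>\<leftarrow>\<mu>s. [:-\<mu>, 1:]) i * g (n + i))"
proof (induction \<mu>s arbitrary: g)
  case (Cons \<mu> \<mu>s)
  define q where "q = (\<Prod>\<mu>\<leftarrow>\<mu>s. [:-\<mu>, 1:])"
  define m where "m = length \<mu>s"
  have "degree q \<le> m"
    unfolding q_def m_def by (induction \<mu>s) (auto intro!: degree_diff_le order.trans[OF degree_pCons_le] order.trans[OF degree_smult_le])
  then have top: "coeff q (Suc m) = 0"
    by (intro coeff_eq_0) auto
  have c: "coeff ([:-\<mu>, 1:] * q) i = (case i of 0 \<Rightarrow> 0 | Suc j \<Rightarrow> coeff q j) - \<mu> * coeff q i" for i
    by (simp add: coeff_pCons split: nat.split)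
  have "(\<Sum>i\<le>Suc m. coeff ([:-\<mu>, 1:] * q) i * g (n + i)) =
      (\<Sum>i\<le>Suc m. (case i of 0 \<Rightarrow> 0 | Suc j \<Rightarrow> coeff q j) * g (n + i)) -
      (\<Sum>i\<le>Suc m. \<mu> * coeff q i * g (n + i))"
    unfolding c by (simp only: left_diff_distrib sum_subtractf)
  also have "(\<Sum>i\<le>Suc m. (case i of 0 \<Rightarrow> 0 | Suc j \<Rightarrow> coeff q j) * g (n + i)) =
      (\<Sum>i\<le>m. coeff q i * g (Suc (n + i)))"
    by (subst sum.atMost_Suc_shift) simp
  also have "(\<Sum>i\<le>Suc m. \<mu> * coeff q i * g (n + i)) = (\<Sum>i\<le>m. \<mu> * coeff q i * g (n + i))"
    using top by simp
  finally have "(\<Sum>i\<le>Suc m. coeff ([:-\<mu>, 1:] * q) i * g (n + i)) =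
      (\<Sum>i\<le>m. coeff q i * (g (Suc (n + i)) - \<mu> * g (n + i)))"
    by (simp add: sum_subtractf algebra_simps)
  then show ?case
    using Cons.IH by (simp add: q_def m_def)
qed simp

lemma shift_norm_nonneg: "w \<ge> 0 \<Longrightarrow> shift_norm w \<mu>s g n \<ge> 0"
  by (induction \<mu>s arbitrary: g) auto

lemma shift_norm_ge:
  assumes "w \<ge> 0" "\<mu>s \<noteq> []"
  shows "cmod (g n) \<le> shift_norm w \<mu>s g n"
  using assms by (cases \<mu>s) (auto simp: shift_norm_nonneg)

text \<open>The recurrence in the coordinates of \<open>shift_norm\<close> is bidiagonal, with \<open>\<mu>s\<close> on the
  diagonal. The negative term lets the induction absorb the off-diagonal entries.\<close>
lemma shift_norm_Suc_le:
  assumes "w > 0" "\<And>\<mu>. \<mu> \<in> set \<mu>s \<Longrightarrow> cmod \<mu> \<le> M"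
  shows "shift_norm w \<mu>s g (Suc n) \<le> (M + 1 / w) * shift_norm w \<mu>s g n
    - cmod (g n) / w + w ^ length \<mu>s / w * cmod (shift_prod \<mu>s g n)"
  using assms(2)
proof (induction \<mu>s arbitrary: g)
  case (Cons \<mu> \<mu>s)
  define g' where "g' = (\<lambda>n. g (Suc n) - \<mu> * g n)"
  define a b where "a = shift_norm w \<mu>s g' n" and "b = shift_norm w \<mu>s g' (Suc n)"
  define e where "e = w ^ length \<mu>s / w * cmod (shift_prod \<mu>s g' n)"
  have "b \<le> (M + 1 / w) * a - cmod (g' n) / w + e"
    using Cons unfolding a_def b_def e_def by auto
  then have "w * b \<le> w * ((M + 1 / w) * a - cmod (g' n) / w + e)"
    using \<open>w > 0\<close> by simp
  then have b: "w * b \<le> w * M * a + a - cmod (g' n) + w * e"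
    using \<open>w > 0\<close> by (simp add: algebra_simps)
  have "cmod (g (Suc n)) \<le> cmod (g' n) + cmod (\<mu> * g n)"
    using norm_triangle_ineq[of "g' n" "\<mu> * g n"] by (simp add: g'_def)
  also have "cmod (\<mu> * g n) \<le> M * cmod (g n)"
    using Cons.prems by (simp add: norm_mult mult_right_mono)
  finally have "cmod (g (Suc n)) + w * b \<le> M * cmod (g n) + w * M * a + a + w * e"
    using b by linarith
  \<comment> \<open>Reading \<open>a\<close> as \<open>(w * a) / w\<close>, and adding and
    subtracting \<open>cmod (g n) / w\<close>, restores the common factor
    \<open>M + 1 / w\<close>.\<close>
  also have "\<dots> = (M + 1 / w) * (cmod (g n) + w * a) - cmod (g n) / w + w * e"
    using \<open>w > 0\<close> by (simp add: field_simps)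
  finally show ?case
    using \<open>w > 0\<close> by (simp add: a_def b_def e_def g'_def)
qed simp

text \<open>The iterated differences up to order m - 1 determine the window g(n), ..., g(n+m-1)
  linearly. The bound \<open>B\<close> is uniform in \<open>g\<close> and \<open>n\<close>, so an
  error measured on the window can be measured in the norm.\<close>

lemma shift_norm_dominates:
  assumes "w > 0"
  obtains B where "B \<ge> 0"
    "\<And>g n j. j < length \<mu>s \<Longrightarrow> cmod (g (n + j)) \<le> B * shift_norm w \<mu>s g n"
proof -
  have "\<exists>B\<ge>0. \<forall>g n j. j < length \<mu>s \<longrightarrow> cmod (g (n + j)) \<le> B * shift_norm w \<mu>s g n"
  proof (induction \<mu>s)
    case Nil
    then show ?case by auto
  next
    case (Cons \<mu> \<mu>s)
    then obtain B where B: "B \<ge> 0"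
      "\<And>g n j. j < length \<mu>s \<Longrightarrow> cmod (g (n + j)) \<le> B * shift_norm w \<mu>s g n"
      by auto
    have "\<exists>C\<ge>0. \<forall>g n. cmod (g (n + j)) \<le> C * shift_norm w (\<mu> # \<mu>s) g n"
      if "j < length (\<mu> # \<mu>s)" for j
      using that
    proof (induction j)
      case 0
      then show ?case
        using shift_norm_ge[of w "\<mu> # \<mu>s"] \<open>w > 0\<close> by (intro exI[of _ 1]) auto
    next
      case (Suc j)
      then obtain C where C: "C \<ge> 0"
        "\<And>g n. cmod (g (n + j)) \<le> C * shift_norm w (\<mu> # \<mu>s) g n"
        by auto
      \<comment> \<open>The witness comes from g(n+j+1) = g'(n+j) + \<mu> g(n+j): the norm of g'
        enters that of g with weight \<open>w\<close>, whence \<open>B / w\<close>, and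
        \<open>C\<close> bounds the other term.\<close>
      show ?case
      proof (intro exI[of _ "B / w + cmod \<mu> * C"] conjI allI)
        fix g n
        define g' where "g' = (\<lambda>n. g (Suc n) - \<mu> * g n)"
        have "cmod (g' (n + j)) \<le> B * shift_norm w \<mu>s g' n"
          using B(2) Suc.prems by simp
        also have "\<dots> \<le> B / w * shift_norm w (\<mu> # \<mu>s) g n"
          using \<open>w > 0\<close> B(1) by (simp add: g'_def field_simps)
        finally have 1: "cmod (g' (n + j)) \<le> B / w * shift_norm w (\<mu> # \<mu>s) g n" .
        have 2: "cmod (\<mu> * g (n + j)) \<le> cmod \<mu> * (C * shift_norm w (\<mu> # \<mu>s) g n)"
          unfolding norm_mult by (intro mult_left_mono C(2)) auto
        have "cmod (g (n + Suc j)) \<le> cmod (g' (n + j)) + cmod (\<mu> * g (n + j))"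
          using norm_triangle_ineq[of "g' (n + j)" "\<mu> * g (n + j)"] by (simp add: g'_def)
        also have "\<dots> \<le> (B / w + cmod \<mu> * C) * shift_norm w (\<mu> # \<mu>s) g n"
          using 1 2 by (simp only: distrib_right mult.assoc)
        finally show "cmod (g (n + Suc j)) \<le> (B / w + cmod \<mu> * C) * shift_norm w (\<mu> # \<mu>s) g n" .
      qed (use B C \<open>w > 0\<close> in auto)
    qed
    then obtain C where C: "\<And>j. j < length (\<mu> # \<mu>s) \<Longrightarrow> C j \<ge> 0"
      "\<And>j g n. j < length (\<mu> # \<mu>s) \<Longrightarrow> cmod (g (n + j)) \<le> C j * shift_norm w (\<mu> # \<mu>s) g n"
      by metis
    show ?case
    proof (intro exI[of _ "\<Sum>j<length (\<mu> # \<mu>s). C j"] conjI allI impI)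
      fix g n j assume j: "j < length (\<mu> # \<mu>s)"
      have "C j \<le> (\<Sum>j<length (\<mu> # \<mu>s). C j)"
        using j C(1) by (intro member_le_sum) auto
      then show "cmod (g (n + j)) \<le> (\<Sum>j<length (\<mu> # \<mu>s). C j) * shift_norm w (\<mu> # \<mu>s) g n"
        using C(2)[OF j, of g n] shift_norm_nonneg[of w "\<mu> # \<mu>s" g n] \<open>w > 0\<close>
        by (meson less_imp_le mult_right_mono order.trans)
    qed (use C(1) in \<open>auto intro!: sum_nonneg simp del: sum.lessThan_Suc\<close>)
  qed
  then show ?thesis using that by auto
qed

section \<open>Invariance of the cone\<close>

text \<open>Inside the cone, one step multiplies the norm of g by at most some \<rho> below
  |\<kappa>|, up to a small error, while |f| grows at least by the factor |\<kappa>| - \<tau>. The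
  constants precede the quantifier over \<open>f\<close> and \<open>n0\<close>, so that they serve
  all points near a given one at once.\<close>

lemma cone_invariance:
  fixes \<kappa> :: complex
  assumes "\<mu>s \<noteq> []" "\<And>\<mu>. \<mu> \<in> set \<mu>s \<Longrightarrow> cmod \<mu> < cmod \<kappa>" "\<eta> > 0"
  obtains w \<tau> \<epsilon> where
    "\<forall>f n0. f n0 \<noteq> 0 \<and>
       shift_norm w \<mu>s (\<lambda>n. f (Suc n) - \<kappa> * f n) n0 \<le> \<tau> * cmod (f n0) \<and>
       (\<forall>n\<ge>n0. cmod (shift_prod (\<kappa> # \<mu>s) f n) \<le> \<epsilon> * (\<Sum>j\<le>length \<mu>s. cmod (f (n + j)))) \<longrightarrow>
       (\<forall>n\<ge>n0. f n \<noteq> 0 \<and> cmod (f (Suc n) - \<kappa> * f n) \<le> \<eta> * cmod (f n))"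
    "w > 0" "\<tau> > 0" "\<epsilon> > 0"
proof -
  define M where "M = Max (cmod ` set \<mu>s)"
  have M: "cmod \<mu> \<le> M" if "\<mu> \<in> set \<mu>s" for \<mu>
    using that by (simp add: M_def)
  have "M < cmod \<kappa>" "M \<ge> 0"
    using assms(1,2) by (auto simp: M_def Max_ge_iff ex_in_conv)
  \<comment> \<open>This choice makes 1/w half the gap between \<open>M\<close> and |\<kappa>|, so
    \<rho> is their midpoint.\<close>
  define w where "w = 2 / (cmod \<kappa> - M)"
  define \<rho> where "\<rho> = M + 1 / w"
  have "w > 0" "\<rho> < cmod \<kappa>" "\<rho> \<ge> 0"
    using \<open>M < cmod \<kappa>\<close> \<open>M \<ge> 0\<close> by (auto simp: w_def \<rho>_def field_simps)
  \<comment> \<open>The bound \<eta> yields the claimed estimate; the other bound keeps half of the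
    gap |\<kappa>| - \<rho> free for the error.\<close>
  define \<tau> where "\<tau> = min \<eta> ((cmod \<kappa> - \<rho>) / 2)"
  have \<tau>: "\<tau> > 0" "\<tau> \<le> \<eta>" "\<tau> \<le> (cmod \<kappa> - \<rho>) / 2"
    using \<open>\<rho> < cmod \<kappa>\<close> \<open>\<eta> > 0\<close> unfolding \<tau>_def by (simp_all only: min.cobounded1 min.cobounded2 min_less_iff_conj, simp)
  define W where "W = w ^ length \<mu>s / w"
  have "W > 0" using \<open>w > 0\<close> by (simp add: W_def)
  obtain B where B: "B \<ge> 0"
    "\<And>g n j. j < length (\<kappa> # \<mu>s) \<Longrightarrow> cmod (g (n + j)) \<le> B * shift_norm w (\<kappa> # \<mu>s) g n"
    using shift_norm_dominates[OF \<open>w > 0\<close>] by blast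
  \<comment> \<open>In the cone, the weighted error at time n is at most
    \<open>\<epsilon> * D * cmod (f n)\<close>: the window has \<open>Suc (length \<mu>s)\<close>
    terms, each at most \<open>B * (1 + w * \<tau>) * cmod (f n)\<close>.\<close>
  define D where "D = W * real (Suc (length \<mu>s)) * B * (1 + w * \<tau>)"
  have "D \<ge> 0"
    using \<open>W > 0\<close> B(1) \<open>w > 0\<close> \<tau>(1) by (simp add: D_def)
  \<comment> \<open>The denominator is \<open>D + 1\<close> because \<open>D\<close> may
    vanish.\<close>
  define \<epsilon> where "\<epsilon> = \<tau> * ((cmod \<kappa> - \<rho>) / 2) / (D + 1)"
  have "\<epsilon> > 0"
    using \<tau>(1) \<open>\<rho> < cmod \<kappa>\<close> \<open>D \<ge> 0\<close> by (simp add: \<epsilon>_def)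
  have "\<epsilon> * D \<le> \<epsilon> * (D + 1)"
    using \<open>\<epsilon> > 0\<close> by simp
  also have "\<epsilon> * (D + 1) = \<tau> * ((cmod \<kappa> - \<rho>) / 2)"
    unfolding \<epsilon>_def using \<open>D \<ge> 0\<close> by (subst nonzero_eq_divide_eq[symmetric]) auto
  also have "\<dots> \<le> \<tau> * (cmod \<kappa> - \<rho> - \<tau>)"
    using \<tau> by (intro mult_left_mono) auto
  \<comment> \<open>The left side bounds the new norm of g and the right side is \<tau> times the
    guaranteed growth of |f|, both relative to |f n|; this is what keeps the cone invariant.\<close>
  finally have \<epsilon>D: "\<epsilon> * D + \<rho> * \<tau> \<le> \<tau> * (cmod \<kappa> - \<tau>)"
    by (simp add: algebra_simps)
  show ?thesis
  proof (rule that[OF _ \<open>w > 0\<close> \<tau>(1) \<open>\<epsilon> > 0\<close>], intro allI impI, elim conjE)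
    fix f n0 n
    define g where "g = (\<lambda>n. f (Suc n) - \<kappa> * f n)"
    assume f0: "f n0 \<noteq> 0"
      and start: "shift_norm w \<mu>s (\<lambda>n. f (Suc n) - \<kappa> * f n) n0 \<le> \<tau> * cmod (f n0)"
      and err: "\<forall>n\<ge>n0.
         cmod (shift_prod (\<kappa> # \<mu>s) f n) \<le> \<epsilon> * (\<Sum>j\<le>length \<mu>s. cmod (f (n + j)))"
      and "n \<ge> n0"
    have g_le: "cmod (g n) \<le> shift_norm w \<mu>s g n" for n
      using shift_norm_ge \<open>w > 0\<close> assms(1) by simp
    have cone: "f n \<noteq> 0 \<and> shift_norm w \<mu>s g n \<le> \<tau> * cmod (f n)"
      using \<open>n \<ge> n0\<close>
    proof (induction n rule: dec_induct)
      case base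
      then show ?case using f0 start by (simp add: g_def)
    next
      case (step n)
      then have N: "shift_norm w \<mu>s g n \<le> \<tau> * cmod (f n)" and fn: "f n \<noteq> 0"
        by auto
      have sn: "shift_norm w (\<kappa> # \<mu>s) f n \<le> (1 + w * \<tau>) * cmod (f n)"
        using N \<open>w > 0\<close> by (simp add: g_def algebra_simps)
      have "cmod (f (n + j)) \<le> B * ((1 + w * \<tau>) * cmod (f n))" if "j \<le> length \<mu>s" for j
      proof -
        have "cmod (f (n + j)) \<le> B * shift_norm w (\<kappa> # \<mu>s) f n"
          using that by (intro B(2)) auto
        then show ?thesis
          using mult_left_mono[OF sn B(1)] by linarith
      qed
      then have "(\<Sum>j\<le>length \<mu>s. cmod (f (n + j))) \<le>
          (\<Sum>j\<le>length \<mu>s. B * ((1 + w * \<tau>) * cmod (f n)))"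
        by (intro sum_mono) auto
      also have "\<dots> = real (Suc (length \<mu>s)) * B * (1 + w * \<tau>) * cmod (f n)"
        by simp
      finally have "\<epsilon> * (\<Sum>j\<le>length \<mu>s. cmod (f (n + j))) \<le>
          \<epsilon> * (real (Suc (length \<mu>s)) * B * (1 + w * \<tau>) * cmod (f n))"
        using \<open>\<epsilon> > 0\<close> by (intro mult_left_mono) auto
      then have "cmod (shift_prod \<mu>s g n) \<le>
          \<epsilon> * (real (Suc (length \<mu>s)) * B * (1 + w * \<tau>) * cmod (f n))"
        using err[rule_format, of n] step.hyps by (simp add: g_def)
      then have "W * cmod (shift_prod \<mu>s g n) \<le>
          W * (\<epsilon> * (real (Suc (length \<mu>s)) * B * (1 + w * \<tau>) * cmod (f n)))"
        using \<open>W > 0\<close> by (intro mult_left_mono) auto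
      also have "\<dots> = \<epsilon> * D * cmod (f n)"
        by (simp only: D_def ac_simps)
      finally have e: "W * cmod (shift_prod \<mu>s g n) \<le> \<epsilon> * D * cmod (f n)" .
      have "shift_norm w \<mu>s g (Suc n) \<le> \<rho> * shift_norm w \<mu>s g n
          - cmod (g n) / w + W * cmod (shift_prod \<mu>s g n)"
        unfolding \<rho>_def W_def using \<open>w > 0\<close> M by (rule shift_norm_Suc_le)
      also have "\<dots> \<le> \<rho> * (\<tau> * cmod (f n)) - 0 + \<epsilon> * D * cmod (f n)"
        using N \<open>\<rho> \<ge> 0\<close> e \<open>w > 0\<close> by (intro add_mono diff_mono mult_left_mono) auto
      also have "\<dots> = (\<epsilon> * D + \<rho> * \<tau>) * cmod (f n)"
        by (simp add: algebra_simps)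
      also have "\<dots> \<le> \<tau> * (cmod \<kappa> - \<tau>) * cmod (f n)"
        by (rule mult_right_mono[OF \<epsilon>D]) simp
      finally have N': "shift_norm w \<mu>s g (Suc n) \<le> \<tau> * ((cmod \<kappa> - \<tau>) * cmod (f n))"
        by (simp add: mult.assoc)
      have "cmod (\<kappa> * f n) \<le> cmod (f (Suc n)) + cmod (g n)"
        using norm_triangle_ineq4[of "f (Suc n)" "g n"] by (simp add: g_def)
      then have f': "(cmod \<kappa> - \<tau>) * cmod (f n) \<le> cmod (f (Suc n))"
        using g_le[of n] N by (simp add: norm_mult algebra_simps)
      have "(cmod \<kappa> - \<tau>) * cmod (f n) > 0"
        using \<tau> \<open>\<rho> < cmod \<kappa>\<close> \<open>\<rho> \<ge> 0\<close> fn by auto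
      then have "f (Suc n) \<noteq> 0"
        using f' by auto
      moreover have "shift_norm w \<mu>s g (Suc n) \<le> \<tau> * cmod (f (Suc n))"
        using N' mult_left_mono[OF f', of \<tau>] \<tau>(1) by linarith
      ultimately show ?case by blast
    qed
    have "cmod (g n) \<le> \<eta> * cmod (f n)"
      using g_le[of n] conjunct2[OF cone] mult_right_mono[OF \<tau>(2) norm_ge_zero[of "f n"]] by linarith
    then show "f n \<noteq> 0 \<and> cmod (f (Suc n) - \<kappa> * f n) \<le> \<eta> * cmod (f n)"
      using cone by (simp add: g_def)
  qed
qed

section \<open>Entering the cone\<close>

text \<open>If g = o(f) and the ratios of f converge, then g(n+1) = o(f(n)) too, so every iterated
  difference in the norm is o(f). Hence convergent ratios bring the solution into the cone, however
  narrow it is.\<close>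

lemma shift_norm_tendsto_0:
  assumes "(\<lambda>n. f (Suc n) / f n) \<longlonglongrightarrow> (\<kappa>::complex)" "\<forall>\<^sub>F n in sequentially. f n \<noteq> 0"
    and "(\<lambda>n. g n / f n) \<longlonglongrightarrow> 0"
  shows "(\<lambda>n. shift_norm w \<mu>s g n / cmod (f n)) \<longlonglongrightarrow> 0"
  using assms(3)
proof (induction \<mu>s arbitrary: g)
  case (Cons \<mu> \<mu>s)
  have "(\<lambda>n. g (Suc n) / f (Suc n) * (f (Suc n) / f n) - \<mu> * (g n / f n)) \<longlonglongrightarrow> 0 * \<kappa> - \<mu> * 0"
    by (intro tendsto_intros assms(1) Cons.prems LIMSEQ_Suc[OF Cons.prems])
  moreover have "\<forall>\<^sub>F n in sequentially. g (Suc n) / f (Suc n) * (f (Suc n) / f n) - \<mu> * (g n / f n)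
      = (g (Suc n) - \<mu> * g n) / f n"
    using eventually_sequentially_Suc[THEN iffD2, OF assms(2)] assms(2)
    by eventually_elim (simp add: field_simps)
  ultimately have "(\<lambda>n. (g (Suc n) - \<mu> * g n) / f n) \<longlonglongrightarrow> 0"
    by (auto elim: Lim_transform_eventually)
  from Cons.IH[OF this]
  have "(\<lambda>n. cmod (g n / f n) + w * (shift_norm w \<mu>s (\<lambda>n. g (Suc n) - \<mu> * g n) n / cmod (f n)))
      \<longlonglongrightarrow> cmod 0 + w * 0"
    by (intro tendsto_intros Cons.prems)
  then show ?case
    by (simp add: norm_divide add_divide_distrib)
qed simp

lemma continuous_on_shift_norm:
  assumes "\<And>n. continuous_on S (\<lambda>x. g n x)"
  shows "continuous_on S (\<lambda>x. shift_norm w \<mu>s (\<lambda>n. g n x) n)"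
  using assms
proof (induction \<mu>s arbitrary: g)
  case (Cons \<mu> \<mu>s)
  have "continuous_on S (\<lambda>x. shift_norm w \<mu>s (\<lambda>n. g (Suc n) x - \<mu> * g n x) n)"
    by (rule Cons.IH) (intro continuous_intros Cons.prems)
  then show ?case
    by (auto intro!: continuous_intros Cons.prems)
qed simp

section \<open>Factorization of the symbol\<close>

lemma maxmod_root_leading_root:
  "maxmod_generic p \<Longrightarrow> maxmod_root p (leading_root p)"
  unfolding leading_root_def maxmod_generic_def by (blast intro: theI')

text \<open>The cofactor of the leading root splits over the complex numbers. Simplicity keeps the
  leading root out of \<open>\<mu>s\<close>, and uniqueness excludes any other root of the same
  modulus.\<close>

lemma maxmod_generic_factorization:
  assumes "maxmod_generic p" "lead_coeff p = 1"
  obtains \<mu>s where "p = (\<Prod>\<mu>\<leftarrow>leading_root p # \<mu>s. [:-\<mu>, 1:])" "Suc (length \<mu>s) = degree p"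
    "\<And>\<mu>. \<mu> \<in> set \<mu>s \<Longrightarrow> cmod \<mu> < cmod (leading_root p)"
proof -
  define \<kappa> where "\<kappa> = leading_root p"
  have \<kappa>: "maxmod_root p \<kappa>"
    unfolding \<kappa>_def by (rule maxmod_root_leading_root[OF assms(1)])
  have ord: "order \<kappa> p = 1" and uniq: "\<And>z. maxmod_root p z \<Longrightarrow> z = \<kappa>"
    using assms(1) \<kappa> by (auto simp: maxmod_generic_def)
  have "p \<noteq> 0" using assms(2) by auto
  then obtain q where q: "p = [:-\<kappa>, 1:] * q" "\<not> [:-\<kappa>, 1:] dvd q"
    using order_decomp[of p \<kappa>] ord by auto
  have "q \<noteq> 0" using q \<open>p \<noteq> 0\<close> by auto
  have "lead_coeff q = 1"
    using assms(2) unfolding q(1) lead_coeff_mult by simp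
  obtain A where A: "size A = degree q" "q = smult (lead_coeff q) (\<Prod>x\<in>#A. [:-x, 1:])"
    using alg_closed_imp_factorization[OF \<open>q \<noteq> 0\<close>] by blast
  obtain \<mu>s where \<mu>s: "mset \<mu>s = A" using ex_mset by blast
  have "q = (\<Prod>\<mu>\<leftarrow>\<mu>s. [:-\<mu>, 1:])"
    using A(2) unfolding \<open>lead_coeff q = 1\<close> \<mu>s[symmetric]
    by (simp flip: prod_mset_prod_list)
  then have p: "p = (\<Prod>\<mu>\<leftarrow>\<kappa> # \<mu>s. [:-\<mu>, 1:])" and qp: "q = (\<Prod>\<mu>\<leftarrow>\<mu>s. [:-\<mu>, 1:])"
    using q(1) by auto
  have len: "Suc (length \<mu>s) = degree p"
    using A(1) \<mu>s \<open>q \<noteq> 0\<close> by (subst q(1), subst degree_mult_eq) auto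
  have less: "cmod \<mu> < cmod \<kappa>" if "\<mu> \<in> set \<mu>s" for \<mu>
  proof -
    have "poly q \<mu> = 0"
      using that unfolding qp by (induction \<mu>s) auto
    then have "\<mu> \<noteq> \<kappa>"
      using q(2) by (auto simp: poly_eq_0_iff_dvd)
    have "poly p \<mu> = 0"
      unfolding q(1) using \<open>poly q \<mu> = 0\<close> by simp
    then have "cmod \<mu> \<le> cmod \<kappa>"
      using \<kappa> by (simp add: maxmod_root_def)
    moreover have "cmod \<mu> \<noteq> cmod \<kappa>"
    proof
      assume "cmod \<mu> = cmod \<kappa>"
      then have "maxmod_root p \<mu>"
        using \<kappa> \<open>poly p \<mu> = 0\<close> by (simp add: maxmod_root_def)
      then show False
        using uniq \<open>\<mu> \<noteq> \<kappa>\<close> by blast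
    qed
    ultimately show ?thesis by linarith
  qed
  show ?thesis
    by (rule that[OF p[unfolded \<kappa>_def] len less[unfolded \<kappa>_def]])
qed

text \<open>The coefficient \<open>c i\<close> sits in degree \<open>k - i\<close>; reindexing gives
  the operator of \<open>shift_prod_eq_sum_coeff\<close> the shape of the recurrence.\<close>

lemma sum_coeff_symbol_poly:
  "(\<Sum>j\<le>k. coeff (symbol_poly k c) j * u (n + j)) = u (n + k) + (\<Sum>i=1..k. c i * u (n + k - i))"
proof -
  have "(\<Sum>j\<le>k. coeff (symbol_poly k c) j * u (n + j)) =
      (\<Sum>j\<le>k. (if k = j then 1 else 0) * u (n + j)) +
      (\<Sum>j\<le>k. \<Sum>i=1..k. (if k - i = j then c i else 0) * u (n + j))"
    by (simp add: symbol_poly_def coeff_sum distrib_right sum.distrib sum_distrib_right)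
  also have "(\<Sum>j\<le>k. (if k = j then 1 else 0) * u (n + j)) = u (n + k)"
    by (subst sum.remove[of _ k]) (auto intro!: sum.neutral)
  also have "(\<Sum>j\<le>k. \<Sum>i=1..k. (if k - i = j then c i else 0) * u (n + j)) =
      (\<Sum>i=1..k. \<Sum>j\<le>k. (if k - i = j then c i else 0) * u (n + j))"
    by (rule sum.swap)
  also have "\<dots> = (\<Sum>i=1..k. c i * u (n + k - i))"
  proof (rule sum.cong)
    fix i assume "i \<in> {1..k}"
    then show "(\<Sum>j\<le>k. (if k - i = j then c i else 0) * u (n + j)) = c i * u (n + k - i)"
      by (subst sum.remove[of _ "k - i"]) (auto intro!: sum.neutral)
  qed simp
  finally show ?thesis .
qed

section \<open>Continuity and uniform limits\<close>

lemma solution_continuous_on: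
  fixes f :: "nat \<Rightarrow> 'a::topological_space \<Rightarrow> complex"
  assumes "\<And>i n. i \<in> {1..k} \<Longrightarrow> continuous_on S (a i n)"
    and "\<And>j. j < k \<Longrightarrow> continuous_on S (f j)"
    and "\<And>n x. x \<in> S \<Longrightarrow> f (n + k) x + (\<Sum>i=1..k. a i n x * f (n + k - i) x) = 0"
  shows "continuous_on S (f n)"
proof (induction n rule: less_induct)
  case (less n)
  show ?case
  proof (cases "n < k")
    case False
    then obtain m where n: "n = m + k"
      by (metis add.commute le_Suc_ex leI)
    have "continuous_on S (\<lambda>x. - (\<Sum>i=1..k. a i m x * f (m + k - i) x))"
      by (intro continuous_intros assms(1) less.IH) (auto simp: n)
    moreover have "f n x = - (\<Sum>i=1..k. a i m x * f (m + k - i) x)" if "x \<in> S" for x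
      using assms(3)[OF that, of m] by (simp add: n eq_neg_iff_add_eq_0)
    ultimately show ?thesis
      by (simp cong: continuous_on_cong_simp)
  qed (use assms(2) in auto)
qed

text \<open>The uniform limit \<open>l\<close> is continuous, so \<open>h n y\<close> is near
  \<open>l y\<close>, which is near \<open>l x\<close>. Applied to the coefficients, this freezes
  them at \<open>x\<close> up to a small error.\<close>

lemma uniform_limit_eventually_near:
  fixes h :: "nat \<Rightarrow> 'a::t2_space \<Rightarrow> 'b::metric_space"
  assumes "uniform_limit U h l sequentially" "open U" "x \<in> U"
    and "\<And>n. continuous_on U (h n)" "\<epsilon> > 0"
  shows "\<exists>V N. open V \<and> x \<in> V \<and> (\<forall>n\<ge>N. \<forall>y\<in>V. dist (h n y) (l x) < \<epsilon>)"
proof -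
  have "continuous_on U l"
    by (rule uniform_limit_theorem[OF _ assms(1)]) (use assms(4) in auto)
  then have "(l \<longlongrightarrow> l x) (nhds x)"
    using assms(2,3) by (simp add: continuous_on_eq_continuous_at isCont_def tendsto_at_iff_tendsto_nhds)
  then have "\<forall>\<^sub>F y in nhds x. dist (l y) (l x) < \<epsilon> / 2"
    using \<open>\<epsilon> > 0\<close> by (intro tendstoD) auto
  then obtain V where V: "open V" "x \<in> V" "\<And>y. y \<in> V \<Longrightarrow> dist (l y) (l x) < \<epsilon> / 2"
    by (auto simp: eventually_nhds)
  obtain N where N: "\<And>n y. n \<ge> N \<Longrightarrow> y \<in> U \<Longrightarrow> dist (h n y) (l y) < \<epsilon> / 2"
    using uniform_limitD[OF assms(1), of "\<epsilon> / 2"] \<open>\<epsilon> > 0\<close> by (auto simp: eventually_sequentially)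
  have "dist (h n y) (l x) < \<epsilon>" if "n \<ge> N" "y \<in> V \<inter> U" for n y
    using N[of n y] V(3)[of y] that dist_triangle_half_l[of "h n y" "l y" \<epsilon> "l x"]
    by (auto simp: dist_commute)
  then show ?thesis
    using V assms(2,3) by (intro exI[of _ "V \<inter> U"] exI[of _ N]) auto
qed

text \<open>A form of continuous convergence; it spares us the continuity of the limit \<open>l\<close>.\<close>
lemma uniform_limit_compactI:
  fixes h :: "nat \<Rightarrow> 'a::t2_space \<Rightarrow> 'b::metric_space"
  assumes "compact K" "\<And>x. x \<in> K \<Longrightarrow> (\<lambda>n. h n x) \<longlonglongrightarrow> l x"
    and near: "\<And>x \<epsilon>. x \<in> K \<Longrightarrow> \<epsilon> > 0 \<Longrightarrow>
      \<exists>V N. open V \<and> x \<in> V \<and> (\<forall>n\<ge>N. \<forall>y\<in>V. dist (h n y) (l x) \<le> \<epsilon>)"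
  shows "uniform_limit K h l sequentially"
proof (rule uniform_limitI)
  fix \<epsilon> :: real assume "\<epsilon> > 0"
  then have "\<forall>x\<in>K. \<exists>V N. open V \<and> x \<in> V \<and> (\<forall>n\<ge>N. \<forall>y\<in>V. dist (h n y) (l x) \<le> \<epsilon> / 3)"
    by (intro ballI near) auto
  from bchoice[OF this] obtain V where "\<forall>x\<in>K. \<exists>N. open (V x) \<and> x \<in> V x \<and>
      (\<forall>n\<ge>N. \<forall>y\<in>V x. dist (h n y) (l x) \<le> \<epsilon> / 3)"
    by blast
  from bchoice[OF this] obtain N where "\<forall>x\<in>K. open (V x) \<and> x \<in> V x \<and>
      (\<forall>n\<ge>N x. \<forall>y\<in>V x. dist (h n y) (l x) \<le> \<epsilon> / 3)"
    by blast
  then have V: "\<And>x. x \<in> K \<Longrightarrow> open (V x)" "\<And>x. x \<in> K \<Longrightarrow> x \<in> V x"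
    and N: "\<And>x n y. x \<in> K \<Longrightarrow> n \<ge> N x \<Longrightarrow> y \<in> V x \<Longrightarrow> dist (h n y) (l x) \<le> \<epsilon> / 3"
    by auto
  obtain F where F: "F \<subseteq> K" "finite F" "K \<subseteq> (\<Union>x\<in>F. V x)"
    using compactE_image[OF assms(1), of K V] V by blast
  \<comment> \<open>If \<open>F\<close> is empty then so is \<open>K\<close>, and the unspecified
    \<open>Max {}\<close> is harmless.\<close>
  have "dist (h n y) (l y) < \<epsilon>" if n: "n \<ge> Max (N ` F)" and "y \<in> K" for n y
  proof -
    obtain x where x: "x \<in> F" "y \<in> V x"
      using F(3) \<open>y \<in> K\<close> by auto
    have "N x \<le> n"
      using n x F(2) by (meson Max_ge finite_imageI imageI order.trans)
    have near_x: "dist (h m y) (l x) \<le> \<epsilon> / 3" if "m \<ge> N x" for m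
      using N x F(1) that by blast
    \<comment> \<open>Letting m tend to infinity at the fixed point \<open>y\<close> bounds the
      variation of \<open>l\<close>, in place of its continuity.\<close>
    have "(\<lambda>m. dist (h m y) (l x)) \<longlonglongrightarrow> dist (l y) (l x)"
      by (intro tendsto_intros assms(2) \<open>y \<in> K\<close>)
    then have "dist (l y) (l x) \<le> \<epsilon> / 3"
      by (rule LIMSEQ_le_const2) (use near_x in blast)
    then show ?thesis
      using near_x[OF \<open>N x \<le> n\<close>] \<open>\<epsilon> > 0\<close> dist_triangle2[of "h n y" "l y" "l x"] by linarith
  qed
  then show "\<forall>\<^sub>F n in sequentially. \<forall>y\<in>K. dist (h n y) (l y) < \<epsilon>"
    by (auto simp: eventually_sequentially)
qed

section \<open>Ratios near a point of convergence\<close>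

text \<open>Solutions at nearby points are treated as perturbations of the recurrence with constant
  coefficients \<open>alim i x\<close>, so \<kappa>, \<open>\<mu>s\<close> and the cone do not vary
  with \<open>y\<close>.\<close>

lemma ratio_near_leading_root:
  fixes f :: "nat \<Rightarrow> 'a::t2_space \<Rightarrow> complex"
  assumes "k \<ge> 2" "open U" "x \<in> U" "\<epsilon> > 0"
    and a_cont: "\<And>i n. i \<in> {1..k} \<Longrightarrow> continuous_on U (a i n)"
    and a_lim: "\<And>i. i \<in> {1..k} \<Longrightarrow> uniform_limit U (a i) (alim i) sequentially"
    and f_cont: "\<And>n. continuous_on U (f n)"
    and rec: "\<And>n y. y \<in> U \<Longrightarrow> f (n + k) y + (\<Sum>i=1..k. a i n y * f (n + k - i) y) = 0"
    and gen: "maxmod_generic (symbol_poly k (\<lambda>i. alim i x))"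
    and ratio: "(\<lambda>n. f (Suc n) x / f n x) \<longlonglongrightarrow> \<Psi>max k alim x"
  shows "\<exists>V N. open V \<and> x \<in> V \<and>
    (\<forall>n\<ge>N. \<forall>y\<in>V. dist (f (Suc n) y / f n y) (\<Psi>max k alim x) \<le> \<epsilon>)"
proof -
  define p where "p = symbol_poly k (\<lambda>i. alim i x)"
  define \<kappa> where "\<kappa> = \<Psi>max k alim x"
  have \<kappa>_eq: "leading_root p = \<kappa>" by (simp add: p_def \<kappa>_def \<Psi>max_def)
  obtain \<mu>s where p: "p = (\<Prod>\<mu>\<leftarrow>\<kappa> # \<mu>s. [:-\<mu>, 1:])" and len: "Suc (length \<mu>s) = k"
    and \<mu>s: "\<And>\<mu>. \<mu> \<in> set \<mu>s \<Longrightarrow> cmod \<mu> < cmod \<kappa>"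
    by (rule maxmod_generic_factorization[OF gen monic_symbol_poly,
          unfolded degree_symbol_poly, folded p_def, unfolded \<kappa>_eq]) (rule that)
  have "\<mu>s \<noteq> []" using len \<open>k \<ge> 2\<close> by auto
  \<comment> \<open>As \<open>k \<ge> 2\<close>, there is another root, and its modulus is strictly
    smaller.\<close>
  then have "\<kappa> \<noteq> 0"
    using \<mu>s by (metis last_in_set norm_not_less_zero norm_zero)
  have shift: "shift_prod (\<kappa> # \<mu>s) u n = u (n + k) + (\<Sum>i=1..k. alim i x * u (n + k - i))" for u n
    unfolding shift_prod_eq_sum_coeff p[symmetric]
    using sum_coeff_symbol_poly[of k "\<lambda>i. alim i x" u n] len by (simp add: p_def)
  obtain w \<tau> \<delta> where cone: "\<forall>f n0. f n0 \<noteq> 0 \<and>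
       shift_norm w \<mu>s (\<lambda>n. f (Suc n) - \<kappa> * f n) n0 \<le> \<tau> * cmod (f n0) \<and>
       (\<forall>n\<ge>n0. cmod (shift_prod (\<kappa> # \<mu>s) f n) \<le> \<delta> * (\<Sum>j\<le>length \<mu>s. cmod (f (n + j)))) \<longrightarrow>
       (\<forall>n\<ge>n0. f n \<noteq> 0 \<and> cmod (f (Suc n) - \<kappa> * f n) \<le> \<epsilon> * cmod (f n))"
      and "w > 0" "\<tau> > 0" "\<delta> > 0"
    by (rule cone_invariance[OF \<open>\<mu>s \<noteq> []\<close> \<mu>s \<open>\<epsilon> > 0\<close>]) (assumption, rule that)
  have "\<exists>V N. open V \<and> x \<in> V \<and> (\<forall>n\<ge>N. \<forall>y\<in>V. dist (a i n y) (alim i x) < \<delta>)" if "i \<in> {1..k}" for i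
    using uniform_limit_eventually_near[OF a_lim[OF that] assms(2,3) a_cont[OF that] \<open>\<delta> > 0\<close>] .
  then obtain V N where V: "\<And>i. i \<in> {1..k} \<Longrightarrow> open (V i)" "\<And>i. i \<in> {1..k} \<Longrightarrow> x \<in> V i"
    and N: "\<And>i n y. i \<in> {1..k} \<Longrightarrow> n \<ge> N i \<Longrightarrow> y \<in> V i \<Longrightarrow> dist (a i n y) (alim i x) < \<delta>"
    by metis
  \<comment> \<open>A vanishing denominator would give the quotient 0, so a nonzero quotient forces
    \<open>f n x\<close> to be nonzero.\<close>
  have "\<forall>\<^sub>F n in sequentially. f (Suc n) x / f n x \<noteq> 0"
    using tendsto_imp_eventually_ne[OF ratio[folded \<kappa>_def] \<open>\<kappa> \<noteq> 0\<close>] .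
  then have f_nz: "\<forall>\<^sub>F n in sequentially. f n x \<noteq> 0"
    by eventually_elim auto
  have "(\<lambda>n. (f (Suc n) x - \<kappa> * f n x) / f n x) \<longlonglongrightarrow> 0"
  proof (rule Lim_transform_eventually)
    show "(\<lambda>n. f (Suc n) x / f n x - \<kappa>) \<longlonglongrightarrow> 0"
      using ratio by (simp add: \<kappa>_def LIM_zero)
    show "\<forall>\<^sub>F n in sequentially. f (Suc n) x / f n x - \<kappa> = (f (Suc n) x - \<kappa> * f n x) / f n x"
      using f_nz by eventually_elim (simp add: field_simps)
  qed
  then have "(\<lambda>n. shift_norm w \<mu>s (\<lambda>n. f (Suc n) x - \<kappa> * f n x) n / cmod (f n x)) \<longlonglongrightarrow> 0"
    by (rule shift_norm_tendsto_0[OF ratio f_nz])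
  then have "\<forall>\<^sub>F n in sequentially.
      shift_norm w \<mu>s (\<lambda>n. f (Suc n) x - \<kappa> * f n x) n / cmod (f n x) < \<tau>"
    using \<open>\<tau> > 0\<close> by (rule order_tendstoD)
  with f_nz have "\<forall>\<^sub>F n in sequentially. f n x \<noteq> 0 \<and>
      shift_norm w \<mu>s (\<lambda>n. f (Suc n) x - \<kappa> * f n x) n < \<tau> * cmod (f n x) \<and> n \<ge> Max (N ` {1..k})"
    using eventually_ge_at_top[of "Max (N ` {1..k})"]
    by eventually_elim (simp add: divide_less_eq)
  then obtain n0 where n0: "f n0 x \<noteq> 0" "n0 \<ge> Max (N ` {1..k})"
      "shift_norm w \<mu>s (\<lambda>n. f (Suc n) x - \<kappa> * f n x) n0 < \<tau> * cmod (f n0 x)"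
    by (metis (mono_tags, lifting) eventually_happens' sequentially_bot)
  \<comment> \<open>The strict inequality makes membership in the cone at the single time
    \<open>n0\<close> an open condition, and also forces \<open>f n0 y\<close> to be
    nonzero.\<close>
  define X where "X = {y \<in> U. shift_norm w \<mu>s (\<lambda>n. f (Suc n) y - \<kappa> * f n y) n0 < \<tau> * cmod (f n0 y)}"
  have "open X"
  proof -
    have "continuous_on U (\<lambda>y. \<tau> * cmod (f n0 y) -
        shift_norm w \<mu>s (\<lambda>n. f (Suc n) y - \<kappa> * f n y) n0)"
      by (intro continuous_intros continuous_on_shift_norm f_cont)
    then have "open (U \<inter> (\<lambda>y. \<tau> * cmod (f n0 y) -
        shift_norm w \<mu>s (\<lambda>n. f (Suc n) y - \<kappa> * f n y) n0) -` {0<..})"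
      using \<open>open U\<close> by (simp add: continuous_on_open_vimage Int_commute)
    also have "U \<inter> (\<lambda>y. \<tau> * cmod (f n0 y) -
        shift_norm w \<mu>s (\<lambda>n. f (Suc n) y - \<kappa> * f n y) n0) -` {0<..} = X"
      by (auto simp: X_def)
    finally show ?thesis .
  qed
  define Y where "Y = X \<inter> (\<Inter>i\<in>{1..k}. V i)"
  have "open Y"
    unfolding Y_def using \<open>open X\<close> V(1) by (intro open_Int open_INT) auto
  moreover have "x \<in> Y"
    using V(2) n0(3) \<open>x \<in> U\<close> by (auto simp: Y_def X_def)
  moreover have "dist (f (Suc n) y / f n y) \<kappa> \<le> \<epsilon>" if "n \<ge> n0" "y \<in> Y" for n y
  proof -
    have "y \<in> U" and start: "shift_norm w \<mu>s (\<lambda>n. f (Suc n) y - \<kappa> * f n y) n0 < \<tau> * cmod (f n0 y)"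
      using that by (auto simp: Y_def X_def)
    have "cmod (shift_prod (\<kappa> # \<mu>s) (\<lambda>n. f n y) n) \<le> \<delta> * (\<Sum>j\<le>length \<mu>s. cmod (f (n + j) y))"
      if "n \<ge> n0" for n
    proof -
      have close: "cmod (alim i x - a i n y) \<le> \<delta>" if i: "i \<in> {1..k}" for i
      proof -
        have "N i \<le> Max (N ` {1..k})"
          using i by (intro Max_ge) auto
        then have "N i \<le> n"
          using \<open>n \<ge> n0\<close> n0(2) by linarith
        then show ?thesis
          using N[OF i] \<open>y \<in> Y\<close> i by (force simp: Y_def dist_norm norm_minus_commute)
      qed
      \<comment> \<open>The second bracket is zero by the recurrence at \<open>y\<close>;
        subtracting it leaves only deviations of the coefficients from their limits at
        \<open>x\<close>.\<close>
      have "shift_prod (\<kappa> # \<mu>s) (\<lambda>n. f n y) n =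
          (f (n + k) y + (\<Sum>i=1..k. alim i x * f (n + k - i) y)) -
          (f (n + k) y + (\<Sum>i=1..k. a i n y * f (n + k - i) y))"
        unfolding shift using rec[OF \<open>y \<in> U\<close>, of n] by simp
      also have "\<dots> = (\<Sum>i=1..k. (alim i x - a i n y) * f (n + k - i) y)"
        by (simp add: left_diff_distrib sum_subtractf)
      finally have "cmod (shift_prod (\<kappa> # \<mu>s) (\<lambda>n. f n y) n) \<le>
          (\<Sum>i=1..k. cmod ((alim i x - a i n y) * f (n + k - i) y))"
        by (simp only: norm_sum)
      also have "\<dots> \<le> (\<Sum>i=1..k. \<delta> * cmod (f (n + k - i) y))"
        unfolding norm_mult using close by (intro sum_mono mult_right_mono) auto
      \<comment> \<open>Since \<open>Suc (length \<mu>s) = k\<close>, the map i to k - i carries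
        1..k onto 0..\<open>length \<mu>s\<close>.\<close>
      also have "\<dots> = (\<Sum>j\<le>length \<mu>s. \<delta> * cmod (f (n + j) y))"
        by (rule sum.reindex_bij_witness[of _ "\<lambda>j. k - j" "\<lambda>i. k - i"]) (use len in auto)
      finally show ?thesis
        by (simp add: sum_distrib_left)
    qed
    moreover have "f n0 y \<noteq> 0"
      using start shift_norm_nonneg[of w \<mu>s "\<lambda>n. f (Suc n) y - \<kappa> * f n y" n0] \<open>w > 0\<close> by auto
    ultimately have "f n y \<noteq> 0 \<and> cmod (f (Suc n) y - \<kappa> * f n y) \<le> \<epsilon> * cmod (f n y)"
      using start \<open>n \<ge> n0\<close> cone[rule_format, of "\<lambda>n. f n y" n0 n] by auto
    moreover from this have "f (Suc n) y / f n y - \<kappa> = (f (Suc n) y - \<kappa> * f n y) / f n y"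
      by (simp add: field_simps)
    ultimately show ?thesis
      by (simp add: dist_norm norm_divide divide_le_eq)
  qed
  ultimately show ?thesis
    unfolding \<kappa>_def by blast
qed

section \<open>The least exceptional set\<close>

theorem theorem6:
  fixes k :: nat
    and \<Omega> :: "(real ^ 'd) set"
    and \<phi> :: "nat \<Rightarrow> nat \<Rightarrow> real ^ 'd \<Rightarrow> complex"
    and \<phi>lim :: "nat \<Rightarrow> real ^ 'd \<Rightarrow> complex"
    and init :: "nat \<Rightarrow> real ^ 'd \<Rightarrow> complex"
    and f :: "nat \<Rightarrow> real ^ 'd \<Rightarrow> complex"
  defines "\<Xi> \<equiv> maxmod_discriminant k \<Omega> \<phi>lim"
  assumes "k \<ge> 2"
    and "open \<Omega>" "connected \<Omega>" "\<Omega> \<noteq> {}"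
    and "\<And>n x. x \<in> \<Omega> \<Longrightarrow> \<phi> k n x \<noteq> 0"
    and "\<And>i x. i \<in> {1..k} \<Longrightarrow> x \<in> \<Omega> \<Longrightarrow> (\<lambda>n. \<phi> i n x) \<longlonglongrightarrow> \<phi>lim i x"
    and "\<And>j x. j < k \<Longrightarrow> x \<in> \<Omega> \<Longrightarrow> f j x = init j x"
    and "\<And>n x. x \<in> \<Omega> \<Longrightarrow> f (n + k) x + (\<Sum>i=1..k. \<phi> i n x * f (n + k - i) x) = 0"
  shows "\<exists>!\<Sigma>. inclusion_minimal (\<lambda>S. S \<subseteq> \<Omega> - \<Xi> \<and>
      ratio_limit f (\<Omega> - (\<Xi> \<union> S)) (\<Psi>max k \<phi>lim) \<and>
      ((\<forall>i\<in>{1..k}. \<forall>n. continuous_on \<Omega> (\<phi> i n)) \<and>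
       (\<forall>j<k. continuous_on \<Omega> (init j)) \<and>
       (\<forall>i\<in>{1..k}. uniform_limit_on_compacts \<Omega> (\<phi> i) (\<phi>lim i)) \<longrightarrow>
       ratio_limit_on_compacts f (\<Omega> - (\<Xi> \<union> S)) (\<Psi>max k \<phi>lim))) \<Sigma>"
proof -
  \<comment> \<open>Every admissible set contains these points by the pointwise limit (i). Once this
    set is itself admissible, it is the least one and hence the only minimal one.\<close>
  define \<Sigma> where "\<Sigma> = {x \<in> \<Omega> - \<Xi>. \<not> (\<lambda>n. f (n + 1) x / f n x) \<longlonglongrightarrow> \<Psi>max k \<phi>lim x}"
  define good where "good = (\<lambda>S. S \<subseteq> \<Omega> - \<Xi> \<and>
      ratio_limit f (\<Omega> - (\<Xi> \<union> S)) (\<Psi>max k \<phi>lim) \<and>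
      ((\<forall>i\<in>{1..k}. \<forall>n. continuous_on \<Omega> (\<phi> i n)) \<and>
       (\<forall>j<k. continuous_on \<Omega> (init j)) \<and>
       (\<forall>i\<in>{1..k}. uniform_limit_on_compacts \<Omega> (\<phi> i) (\<phi>lim i)) \<longrightarrow>
       ratio_limit_on_compacts f (\<Omega> - (\<Xi> \<union> S)) (\<Psi>max k \<phi>lim)))"
  have least: "\<Sigma> \<subseteq> S" if "good S" for S
    using that by (auto simp: good_def \<Sigma>_def ratio_limit_def)
  have "ratio_limit_on_compacts f (\<Omega> - (\<Xi> \<union> \<Sigma>)) (\<Psi>max k \<phi>lim)"
    if \<phi>_cont: "\<forall>i\<in>{1..k}. \<forall>n. continuous_on \<Omega> (\<phi> i n)"
      and init_cont: "\<forall>j<k. continuous_on \<Omega> (init j)"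
      and \<phi>_lim: "\<forall>i\<in>{1..k}. uniform_limit_on_compacts \<Omega> (\<phi> i) (\<phi>lim i)"
    unfolding ratio_limit_on_compacts_def uniform_limit_on_compacts_def
  proof (intro allI impI)
    fix K assume K: "compact K \<and> K \<subseteq> \<Omega> - (\<Xi> \<union> \<Sigma>)"
    have "continuous_on \<Omega> (f j)" if "j < k" for j
      using init_cont that assms(8) by (simp cong: continuous_on_cong_simp)
    then have f_cont: "continuous_on \<Omega> (f n)" for n
      using solution_continuous_on[of k \<Omega> \<phi> f] \<phi>_cont assms(9) by blast
    show "uniform_limit K (\<lambda>n x. f (n + 1) x / f n x) (\<Psi>max k \<phi>lim) sequentially"
    proof (rule uniform_limit_compactI)
      show lim: "(\<lambda>n. f (n + 1) x / f n x) \<longlonglongrightarrow> \<Psi>max k \<phi>lim x" if "x \<in> K" for x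
        using that K by (auto simp: \<Sigma>_def)
      fix x and \<epsilon> :: real assume "x \<in> K" "\<epsilon> > 0"
      then have "x \<in> \<Omega>" "maxmod_generic (symbol_poly k (\<lambda>i. \<phi>lim i x))"
        using K by (auto simp: \<Xi>_def maxmod_discriminant_def)
      \<comment> \<open>Uniform convergence is given on compact sets only; a closed ball inside
        \<Omega> provides it on an open neighbourhood of \<open>x\<close>.\<close>
      then obtain r where r: "r > 0" "cball x r \<subseteq> \<Omega>"
        using \<open>open \<Omega>\<close> open_contains_cball by blast
      then have sub: "ball x r \<subseteq> \<Omega>"
        using ball_subset_cball by blast
      have "uniform_limit (ball x r) (\<phi> i) (\<phi>lim i) sequentially" if "i \<in> {1..k}" for i
        using that \<phi>_lim r compact_cball ball_subset_cball
        by (meson uniform_limit_on_compacts_def uniform_limit_on_subset)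
      then show "\<exists>V N. open V \<and> x \<in> V \<and>
          (\<forall>n\<ge>N. \<forall>y\<in>V. dist (f (n + 1) y / f n y) (\<Psi>max k \<phi>lim x) \<le> \<epsilon>)"
        unfolding Suc_eq_plus1[symmetric]
      proof (intro ratio_near_leading_root[of k "ball x r" x \<epsilon> \<phi> \<phi>lim f])
        show "continuous_on (ball x r) (\<phi> i n)" if "i \<in> {1..k}" for i n
          using \<phi>_cont that sub continuous_on_subset by blast
        show "continuous_on (ball x r) (f n)" for n
          using f_cont sub continuous_on_subset by blast
        show "f (n + k) y + (\<Sum>i=1..k. \<phi> i n y * f (n + k - i) y) = 0" if "y \<in> ball x r" for n y
          using assms(9) sub that by blast
        show "(\<lambda>n. f (Suc n) x / f n x) \<longlonglongrightarrow> \<Psi>max k \<phi>lim x"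
          using lim[OF \<open>x \<in> K\<close>] by simp
      qed (use \<open>k \<ge> 2\<close> \<open>\<epsilon> > 0\<close> r(1) \<open>maxmod_generic (symbol_poly k (\<lambda>i. \<phi>lim i x))\<close> in auto)
    qed (use K in auto)
  qed
  then have "good \<Sigma>"
    by (auto simp: good_def \<Sigma>_def ratio_limit_def)
  with least have "\<exists>!\<Sigma>. inclusion_minimal good \<Sigma>"
    unfolding inclusion_minimal_def by (intro ex1I[of _ \<Sigma>]) (auto, blast+)
  then show ?thesis
    unfolding good_def .
qed

end
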